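(* Let $X_1,X_2,\dots\in\mathcal{X}$ be a sequence of random variables (not necessarily i.i.d.). Consider a Gibbs partition mixture model. Let $t\in\{1,2,\dots\}$ and suppose that (i) $\limsup_{n\to\infty}c_{w_n}<\infty$ and $\limsup_{n\to\infty}c_{v_n}(t)<\infty$; and (ii) $\displaystyle\sup_{c\in[0,\infty)}\liminf_{n\to\infty}\phi_t(X_{1:n},c)>0$ with probability $1$. Then $$\limsup_{n\to\infty}\,p(T_n=t\mid X_{1:n})<1\quad\text{with probability }1.$$ If, further, the sequence $X_1,X_2,\dots$ is i.i.d. from a mixture with $t$ components, then with probability $1$ the posterior of $T_n$ (under the model) is not consistent for $t$.
   Context: **Partitions.** For $n\ge1$ and $1\le t\le n$, $\mathcal{A}_t(n)$ is the set of ordered partitions $A=(A_1,\dots,A_t)$ of $\{1,\dots,n\}$ into $t$ nonempty disjoint sets (parts). **Gibbs partition mixture model.** For each $n$ there are functions $v_n,w_n:\{1,\dots,n\}\to[0,\infty)$ such that $p(A)=v_n(t)\prod_{i=1}^t w_n(|A_i|)$, $A\in\mathcal{A}_t(n)$, is a probability mass function on $\bigcup_{t=1}^n\mathcal{A}_t(n)$ ($v_n,w_n$ may vary arbitrarily with $n$). Given $A\in\mathcal{A}_t(n)$, parameters $\theta_1,\dots,\theta_t\in\Theta\subset\mathbb{R}^k$ are i.i.d. from a prior density $\pi$ with respect to Lebesgue measure, and given these the $x_j$, $j\in A_i$, are independent with density $p_{\theta_i}$ with respect to a sigma-finite Borel measure $\lambda$ on $\mathcal{X}\subset\mathbb{R}^d$;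 $(\theta,x)\mapsto p_\theta(x)$ is measurable. For $J\subset\{1,\dots,n\}$ and $x_J=(x_j:j\in J)$, the single-cluster marginal is $$m(x_J)=\int_\Theta\Big(\prod_{j\in J}p_\theta(x_j)\Big)\pi(\theta)\,d\theta,$$ assumed finite, with $m(x_\varnothing)=1$. With $T_n$ the number of clusters (parts), $$p(x_{1:n},T_n=t)=\sum_{A\in\mathcal{A}_t(n)}p(A)\prod_{i=1}^t m(x_{A_i})$$ (equal to $0$ if $t>n$), and $p(T_n=t\mid x_{1:n})=p(x_{1:n},T_n=t)/\sum_{t'\ge1}p(x_{1:n},T_n=t')$ when the denominator is nonzero, and $0$ otherwise. **Constants.** For $n>t\ge1$, $$c_{w_n}=\max_{a\in\{2,\dots,n\}}\frac{w_n(a)}{a\,w_n(a-1)\,w_n(1)},\qquad c_{v_n}(t)=\frac{v_n(t)}{v_n(t+1)},$$ with $0/0=0$ and $y/0=\infty$ for $y>0$. **The function $\phi_t$.** For $n\ge t\ge1$, $x_1,\dots,x_n\in\mathcal{X}$, $c\in[0,\infty)$, $\phi_t(x_{1:n},c)=\min_{A\in\mathcal{A}_t(n)}\frac1n|S_A(x_{1:n},c)|$, where $S_A(x_{1:n},c)$ is the set of $j\in\{1,\dots,n\}$ such that the part $A_\ell$ containing $j$ satisfies $m(x_{A_\ell})\le c\,m(x_{A_\ell\smallsetminus\{j\}})\,m(x_j)$. A mixture with $t$ components is a distribution with density $\sum_{i=1}^t q_ip_{\theta(i)}$ with respect to $\lambda$, with $\theta(i)\in\Theta$, $q_i\ge0$,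 $\sum_iq_i=1$. The posterior is consistent for $t$ if $p(T_n=t\mid X_{1:n})\to1$ as $n\to\infty$. *)

theory Defs
  imports "HOL-Probability.Probability"
begin

text \<open>
  Data are sequences \<open>x\<close> indexed from 1; only \<open>x 1, \<dots>, x n\<close> enter the quantities for sample
  size \<open>n\<close>. The ordered partition \<open>(A\<^sub>1, \<dots>, A\<^sub>t)\<close> is the list of its parts, so the part
  \<open>A\<^sub>i\<close> is \<open>A ! (i - 1)\<close>. The functions \<open>v\<^sub>n\<close> and \<open>w\<^sub>n\<close> are \<open>v n\<close> and \<open>w n\<close>.
\<close>

definition ordered_partitions :: "nat \<Rightarrow> nat \<Rightarrow> nat set list set" where
  "ordered_partitions t n =
     {A. length A = t \<and> (\<forall>i<t. A ! i \<noteq> {}) \<and> disjoint_family_on ((!) A) {..<t} \<and>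
         (\<Union>i<t. A ! i) = {1..n}}"

definition gibbs_weight ::
  "(nat \<Rightarrow> nat \<Rightarrow> real) \<Rightarrow> (nat \<Rightarrow> nat \<Rightarrow> real) \<Rightarrow> nat \<Rightarrow> nat set list \<Rightarrow> real" where
  "gibbs_weight v w n A = v n (length A) * (\<Prod>i<length A. w n (card (A ! i)))"

text \<open>
  The \<open>\<sigma>\<close>-algebra of \<open>\<mu>\<close> is the Borel \<open>\<sigma>\<close>-algebra of the subspace \<open>\<X>\<close>, so
  \<open>space \<mu> = \<X>\<close>. Since the integrand in \<open>marginal_finite\<close> is measurable and nonnegative,
  integrability says exactly that the single-cluster marginal is finite.
\<close>

locale gibbs_partition_mixture = sigma_finite_measure \<mu>
  for \<mu> :: "(real ^ 'd) measure" +
  fixes \<X> :: "(real ^ 'd) set"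
    and \<Theta> :: "(real ^ 'k) set"
    and p :: "real ^ 'k \<Rightarrow> real ^ 'd \<Rightarrow> real"
    and \<pi> :: "real ^ 'k \<Rightarrow> real"
    and v w :: "nat \<Rightarrow> nat \<Rightarrow> real"
  assumes sets_mu: "sets \<mu> = sets (restrict_space borel \<X>)"
    and Theta_measurable: "\<Theta> \<in> sets lebesgue"
    and p_measurable: "(\<lambda>(\<theta>, x). p \<theta> x) \<in> borel_measurable (lebesgue_on \<Theta> \<Otimes>\<^sub>M \<mu>)"
    and p_nonneg: "\<And>\<theta> x. \<theta> \<in> \<Theta> \<Longrightarrow> x \<in> \<X> \<Longrightarrow> p \<theta> x \<ge> 0"
    and p_density: "\<And>\<theta>. \<theta> \<in> \<Theta> \<Longrightarrow> prob_space (density \<mu> (\<lambda>x. ennreal (p \<theta> x)))"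
    and prior_measurable: "\<pi> \<in> borel_measurable (lebesgue_on \<Theta>)"
    and prior_nonneg: "\<And>\<theta>. \<theta> \<in> \<Theta> \<Longrightarrow> \<pi> \<theta> \<ge> 0"
    and prior_density: "prob_space (density (lebesgue_on \<Theta>) (\<lambda>\<theta>. ennreal (\<pi> \<theta>)))"
    and marginal_finite: "\<And>J (x :: nat \<Rightarrow> real ^ 'd). finite J \<Longrightarrow> (\<forall>j\<in>J. x j \<in> \<X>) \<Longrightarrow>
          integrable (lebesgue_on \<Theta>) (\<lambda>\<theta>. (\<Prod>j\<in>J. p \<theta> (x j)) * \<pi> \<theta>)"
    and v_nonneg: "\<And>n t. 1 \<le> t \<Longrightarrow> t \<le> n \<Longrightarrow> v n t \<ge> 0"
    and w_nonneg: "\<And>n a. 1 \<le> a \<Longrightarrow> a \<le> n \<Longrightarrow> w n a \<ge> 0"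
    and gibbs_pmf: "\<And>n. n \<ge> 1 \<Longrightarrow>
          (\<Sum>A\<in>(\<Union>t\<in>{1..n}. ordered_partitions t n). gibbs_weight v w n A) = 1"

definition marginal ::
  "(real ^ 'k) set \<Rightarrow> (real ^ 'k \<Rightarrow> real ^ 'd \<Rightarrow> real) \<Rightarrow> (real ^ 'k \<Rightarrow> real) \<Rightarrow>
   (nat \<Rightarrow> real ^ 'd) \<Rightarrow> nat set \<Rightarrow> real" where
  "marginal \<Theta> p \<pi> x J = (LINT \<theta>|lebesgue_on \<Theta>. (\<Prod>j\<in>J. p \<theta> (x j)) * \<pi> \<theta>)"

definition joint ::
  "(real ^ 'k) set \<Rightarrow> (real ^ 'k \<Rightarrow> real ^ 'd \<Rightarrow> real) \<Rightarrow> (real ^ 'k \<Rightarrow> real) \<Rightarrow>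
   (nat \<Rightarrow> nat \<Rightarrow> real) \<Rightarrow> (nat \<Rightarrow> nat \<Rightarrow> real) \<Rightarrow>
   (nat \<Rightarrow> real ^ 'd) \<Rightarrow> nat \<Rightarrow> nat \<Rightarrow> real" where
  "joint \<Theta> p \<pi> v w x n t =
     (\<Sum>A\<in>ordered_partitions t n. gibbs_weight v w n A * (\<Prod>i<t. marginal \<Theta> p \<pi> x (A ! i)))"

text \<open>
  The sum over all \<open>t' \<ge> 1\<close> stops at \<open>n\<close>, because there are no partitions into more parts.
  A zero denominator gives posterior probability \<open>0\<close>.
\<close>

definition posterior ::
  "(real ^ 'k) set \<Rightarrow> (real ^ 'k \<Rightarrow> real ^ 'd \<Rightarrow> real) \<Rightarrow> (real ^ 'k \<Rightarrow> real) \<Rightarrow>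
   (nat \<Rightarrow> nat \<Rightarrow> real) \<Rightarrow> (nat \<Rightarrow> nat \<Rightarrow> real) \<Rightarrow>
   (nat \<Rightarrow> real ^ 'd) \<Rightarrow> nat \<Rightarrow> nat \<Rightarrow> real" where
  "posterior \<Theta> p \<pi> v w x n t =
     joint \<Theta> p \<pi> v w x n t / (\<Sum>t'\<in>{1..n}. joint \<Theta> p \<pi> v w x n t')"

definition posterior_consistent ::
  "(real ^ 'k) set \<Rightarrow> (real ^ 'k \<Rightarrow> real ^ 'd \<Rightarrow> real) \<Rightarrow> (real ^ 'k \<Rightarrow> real) \<Rightarrow>
   (nat \<Rightarrow> nat \<Rightarrow> real) \<Rightarrow> (nat \<Rightarrow> nat \<Rightarrow> real) \<Rightarrow>
   (nat \<Rightarrow> real ^ 'd) \<Rightarrow> nat \<Rightarrow> bool" where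
  "posterior_consistent \<Theta> p \<pi> v w x t \<longleftrightarrow> (\<lambda>n. posterior \<Theta> p \<pi> v w x n t) \<longlonglongrightarrow> 1"

text \<open>
  Division on \<^typ>\<open>ennreal\<close> satisfies \<open>0 / 0 = 0\<close> and \<open>y / 0 = \<infinity>\<close> for \<open>y > 0\<close>.
\<close>

definition c_w :: "(nat \<Rightarrow> nat \<Rightarrow> real) \<Rightarrow> nat \<Rightarrow> ennreal" where
  "c_w w n = (MAX a\<in>{2..n}. ennreal (w n a) / ennreal (real a * w n (a - 1) * w n 1))"

definition c_v :: "(nat \<Rightarrow> nat \<Rightarrow> real) \<Rightarrow> nat \<Rightarrow> nat \<Rightarrow> ennreal" where
  "c_v v t n = ennreal (v n t) / ennreal (v n (t + 1))"

definition split_set ::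
  "(real ^ 'k) set \<Rightarrow> (real ^ 'k \<Rightarrow> real ^ 'd \<Rightarrow> real) \<Rightarrow> (real ^ 'k \<Rightarrow> real) \<Rightarrow>
   nat set list \<Rightarrow> (nat \<Rightarrow> real ^ 'd) \<Rightarrow> nat \<Rightarrow> real \<Rightarrow> nat set" where
  "split_set \<Theta> p \<pi> A x n c =
     {j \<in> {1..n}. \<exists>l<length A. j \<in> A ! l \<and>
        marginal \<Theta> p \<pi> x (A ! l) \<le> c * marginal \<Theta> p \<pi> x (A ! l - {j}) * marginal \<Theta> p \<pi> x {j}}"

definition phi ::
  "(real ^ 'k) set \<Rightarrow> (real ^ 'k \<Rightarrow> real ^ 'd \<Rightarrow> real) \<Rightarrow> (real ^ 'k \<Rightarrow> real) \<Rightarrow>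
   nat \<Rightarrow> (nat \<Rightarrow> real ^ 'd) \<Rightarrow> nat \<Rightarrow> real \<Rightarrow> real" where
  "phi \<Theta> p \<pi> t x n c =
     (MIN A\<in>ordered_partitions t n. real (card (split_set \<Theta> p \<pi> A x n c)) / real n)"

definition mixture_density ::
  "(real ^ 'k) set \<Rightarrow> (real ^ 'k \<Rightarrow> real ^ 'd \<Rightarrow> real) \<Rightarrow> nat \<Rightarrow> (real ^ 'd \<Rightarrow> real) \<Rightarrow> bool" where
  "mixture_density \<Theta> p t f \<longleftrightarrow>
     (\<exists>q \<theta>. (\<forall>i\<in>{1..t}. \<theta> i \<in> \<Theta> \<and> q i \<ge> 0) \<and> (\<Sum>i\<in>{1..t}. q i) = 1 \<and>
            f = (\<lambda>x. \<Sum>i\<in>{1..t}. q i * p (\<theta> i) x))"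

definition iid_from_mixture ::
  "'a measure \<Rightarrow> (nat \<Rightarrow> 'a \<Rightarrow> real ^ 'd) \<Rightarrow> (real ^ 'd) measure \<Rightarrow> (real ^ 'k) set \<Rightarrow>
   (real ^ 'k \<Rightarrow> real ^ 'd \<Rightarrow> real) \<Rightarrow> nat \<Rightarrow> bool" where
  "iid_from_mixture M X \<mu> \<Theta> p t \<longleftrightarrow>
     prob_space.indep_vars M (\<lambda>_. \<mu>) X {1..} \<and>
     (\<exists>f. mixture_density \<Theta> p t f \<and> (\<forall>j\<ge>1. distributed M \<mu> (X j) (\<lambda>x. ennreal (f x))))"

end

theory Submission
  imports Defs
begin

text \<open>
  Splitting an element \<open>j\<close> off a part of a partition into \<open>t\<close> parts gives a partition into
  \<open>t + 1\<close> parts. For \<open>j\<close> in the set \<open>S\<^sub>A\<close>, this decreases the joint weight by at most a factor of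
  order \<open>n\<close>, because of the bounds on \<open>c_w\<close> and \<open>c_v\<close>. There are at least \<open>n \<phi>\<^sub>t - t\<close> such
  splittings of \<open>A\<close>, while a partition into \<open>t + 1\<close> parts arises from at most \<open>t\<close> pairs \<open>(A, j)\<close>.
  Hence \<open>p(x, T = t) \<le> K p(x, T = t + 1)\<close> eventually, with \<open>K\<close> independent of \<open>n\<close>, and the
  posterior probability of \<open>t\<close> is at most \<open>K / (K + 1)\<close>.
\<close>

section \<open>Combinatorics of splitting one element off a part\<close>

definition split_off :: "'b set list \<Rightarrow> nat \<Rightarrow> 'b \<Rightarrow> 'b set list" where
  "split_off A l j = A[l := A ! l - {j}] @ [{j}]"

lemma length_split_off [simp]: "length (split_off A l j) = Suc (length A)"
  by (simp add: split_off_def)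

lemma nth_split_off:
  "i < length A \<Longrightarrow> split_off A l j ! i = (if i = l then A ! l - {j} else A ! i)"
  "split_off A l j ! length A = {j}"
  by (auto simp: split_off_def nth_append)

lemma finite_ordered_partitions: "finite (ordered_partitions t n)"
proof (rule finite_subset)
  show "ordered_partitions t n \<subseteq> {A. set A \<subseteq> Pow {1..n} \<and> length A = t}"
  proof
    fix A assume "A \<in> ordered_partitions t n"
    then have "length A = t" "(\<Union>i<t. A ! i) = {1..n}"
      by (auto simp: ordered_partitions_def)
    then show "A \<in> {A. set A \<subseteq> Pow {1..n} \<and> length A = t}"
      unfolding in_set_conv_nth subset_iff mem_Collect_eq Pow_iff by blast
  qed
  show "finite {A. set A \<subseteq> Pow {1..n} \<and> length A = t}"
    by (rule finite_lists_length_eq) simp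
qed

lemma ordered_partitionsD:
  assumes "A \<in> ordered_partitions t n"
  shows "length A = t" "\<And>i. i < t \<Longrightarrow> A ! i \<noteq> {}" "\<And>i. i < t \<Longrightarrow> A ! i \<subseteq> {1..n}"
    "\<And>i k. i < t \<Longrightarrow> k < t \<Longrightarrow> i \<noteq> k \<Longrightarrow> A ! i \<inter> A ! k = {}"
    "(\<Union>i<t. A ! i) = {1..n}"
  using assms by (auto simp: ordered_partitions_def disjoint_family_on_def)

text \<open>The sets \<open>A ! l - {j}\<close> and \<open>{j}\<close> divide the old part
  \<open>A ! l\<close> between them, so disjointness and the union are preserved. The bound
  \<open>card (A ! l) \<ge> 2\<close> keeps the remainder nonempty.\<close>

lemma split_off_ordered_partitions:
  assumes A: "A \<in> ordered_partitions t n" and l: "l < t" and j: "j \<in> A ! l"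
    and c: "card (A ! l) \<ge> 2"
  shows "split_off A l j \<in> ordered_partitions (Suc t) n"
proof -
  note AD = ordered_partitionsD[OF A]
  have ne: "A ! l - {j} \<noteq> {}"
  proof
    assume "A ! l - {j} = {}"
    then have "A ! l = {j}" using j by auto
    then show False using c by simp
  qed
  have nth: "split_off A l j ! i = (if i = t then {j} else if i = l then A ! l - {j} else A ! i)"
    if "i < Suc t" for i
    using that nth_split_off(1)[of i A l j] nth_split_off(2)[of A l j] AD(1) by auto
  have jn: "j \<notin> A ! i" if "i < t" "i \<noteq> l" for i
    using AD(4)[OF that(1) l that(2)] j by auto
  have "disjoint_family_on ((!) (split_off A l j)) {..<Suc t}"
    unfolding disjoint_family_on_def
  proof (intro ballI impI)
    fix i k assume ik: "i \<in> {..<Suc t}" "k \<in> {..<Suc t}" "i \<noteq> k"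
    then show "split_off A l j ! i \<inter> split_off A l j ! k = {}"
      using AD(4)[of i k] jn[of i] jn[of k]
      by (auto simp: nth less_Suc_eq split: if_splits)
  qed
  moreover have "(\<Union>i<Suc t. split_off A l j ! i) = {1..n}"
  proof -
    have "(\<Union>i<Suc t. split_off A l j ! i) = {j} \<union> (\<Union>i<t. if i = l then A ! l - {j} else A ! i)"
      by (auto simp: nth less_Suc_eq)
    also have "\<dots> = (\<Union>i<t. A ! i)"
      using l j by (auto split: if_splits)
    finally show ?thesis using AD(5) by simp
  qed
  ultimately show ?thesis
    using AD(1,2) ne by (auto simp: ordered_partitions_def nth less_Suc_eq)
qed

text \<open>The last entry reveals \<open>j\<close>, and putting it back into entry \<open>l\<close>
  restores \<open>A\<close>; this is why the new singleton is appended and the remainder stays in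
  its place. The index \<open>l\<close> is the same on both sides, so a list has at most one
  preimage for each \<open>l\<close>, which is the source of the factor \<open>t\<close> in the
  counting.\<close>

lemma split_off_inject:
  assumes "split_off A l j = split_off A' l j'" "j \<in> A ! l" "j' \<in> A' ! l" "l < length A"
  shows "A = A' \<and> j = j'"
proof -
  have j: "j = j'" and u: "A[l := A ! l - {j}] = A'[l := A' ! l - {j'}]"
    using assms(1) by (auto simp: split_off_def)
  have len: "length A = length A'"
    using u by (metis length_list_update)
  have "A ! l - {j} = A' ! l - {j}"
    using u j len assms(4) by (metis nth_list_update_eq)
  then have "A ! l = A' ! l" using assms(2,3) j by auto
  with u j len have "A = A'" by (metis list_update_id list_update_overwrite)
  with j show ?thesis by simp
qed

text \<open>Only the factor of the part \<open>A ! l\<close> changes, becoming a product of two; the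
  remaining factors are common to both sides and nonnegative.\<close>

lemma prod_le_prod_split_off:
  fixes g :: "'b set \<Rightarrow> real"
  assumes l: "l < length A" and nonneg: "\<And>i. i < length A \<Longrightarrow> g (A ! i) \<ge> 0"
    and le: "g (A ! l) \<le> C * (g (A ! l - {j}) * g {j})"
  shows "(\<Prod>i<length A. g (A ! i)) \<le> C * (\<Prod>i<Suc (length A). g (split_off A l j ! i))"
proof -
  let ?R = "\<Prod>i\<in>{..<length A} - {l}. g (A ! i)"
  have split: "(\<Prod>i<length A. g (split_off A l j ! i)) = g (A ! l - {j}) * ?R"
    using l by (subst prod.remove[of _ l]) (auto simp: nth_split_off intro!: prod.cong)
  have "(\<Prod>i<length A. g (A ! i)) = g (A ! l) * ?R"
    using l by (subst prod.remove[of _ l]) auto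
  also have "\<dots> \<le> C * (g (A ! l - {j}) * g {j}) * ?R"
    using le nonneg by (intro mult_right_mono prod_nonneg) auto
  finally show ?thesis
    by (simp add: nth_split_off(2) split mult_ac)
qed

text \<open>
  The loss of \<open>t\<close> accounts for the elements of singleton parts, which cannot be split off.
\<close>

lemma sum_partitions_le_sum_split:
  fixes g :: "nat set \<Rightarrow> real" and P :: "nat set \<Rightarrow> nat \<Rightarrow> bool" and k C :: real
  assumes nonneg: "\<And>J. J \<subseteq> {1..n} \<Longrightarrow> J \<noteq> {} \<Longrightarrow> g J \<ge> 0" and C: "C \<ge> 0"
    and split: "\<And>J j. J \<subseteq> {1..n} \<Longrightarrow> j \<in> J \<Longrightarrow> card J \<ge> 2 \<Longrightarrow> P J j
      \<Longrightarrow> g J \<le> C * (g (J - {j}) * g {j})"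
    and card: "\<And>A. A \<in> ordered_partitions t n \<Longrightarrow>
      k \<le> card {j \<in> {1..n}. \<exists>l<t. j \<in> A ! l \<and> P (A ! l) j}"
  shows "(k - t) * (\<Sum>A\<in>ordered_partitions t n. \<Prod>i<t. g (A ! i))
    \<le> C * t * (\<Sum>B\<in>ordered_partitions (Suc t) n. \<Prod>i<Suc t. g (B ! i))"
proof -
  \<comment> \<open>These are the elements whose removal both keeps the part nonempty and satisfies
    the weight bound in \<open>split\<close>.\<close>
  define R where "R A l = {j \<in> A ! l. card (A ! l) \<ge> 2 \<and> P (A ! l) j}" for A :: "nat set list" and l
  define F where "F A = (\<Prod>i<length A. g (A ! i))" for A
  let ?Q = "ordered_partitions (Suc t) n"
  have F_nonneg: "F A \<ge> 0" if "A \<in> ordered_partitions s n" for A s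
    unfolding F_def using ordered_partitionsD[OF that] by (intro prod_nonneg ballI nonneg) auto
  have fin: "finite (R A l)" if "A \<in> ordered_partitions t n" "l < t" for A l
    using ordered_partitionsD(3)[OF that] unfolding R_def
    by (metis (no_types, lifting) finite_atLeastAtMost finite_subset mem_Collect_eq subsetI)
  have pointwise: "(k - t) * F A \<le> C * (\<Sum>l<t. \<Sum>j\<in>R A l. F (split_off A l j))"
    if A: "A \<in> ordered_partitions t n" for A
  proof -
    note AD = ordered_partitionsD[OF A]
    \<comment> \<open>A part with fewer than two elements gives an empty \<open>R A l\<close> and
      loses at most one element. Over \<open>t\<close> parts the total loss is at most
      \<open>t\<close>.\<close>
    have piece: "card {j \<in> A ! l. P (A ! l) j} \<le> card (R A l) + 1" if l: "l < t" for l
    proof (cases "card (A ! l) \<ge> 2")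
      case True
      then show ?thesis by (simp add: R_def)
    next
      case False
      have "finite (A ! l)" using AD(3)[OF l] finite_subset by blast
      then have "card {j \<in> A ! l. P (A ! l) j} \<le> card (A ! l)"
        by (intro card_mono) auto
      with False show ?thesis by simp
    qed
    have "{j \<in> {1..n}. \<exists>l<t. j \<in> A ! l \<and> P (A ! l) j} = (\<Union>l<t. {j \<in> A ! l. P (A ! l) j})"
      unfolding AD(5)[symmetric] by blast
    then have "card {j \<in> {1..n}. \<exists>l<t. j \<in> A ! l \<and> P (A ! l) j}
        \<le> (\<Sum>l<t. card {j \<in> A ! l. P (A ! l) j})"
      by (simp add: card_UN_le)
    also have "\<dots> \<le> (\<Sum>l<t. card (R A l) + 1)"
      by (intro sum_mono piece) simp
    also have "\<dots> = (\<Sum>l<t. card (R A l)) + t"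
      by (simp add: sum_Suc)
    finally have "real (card {j \<in> {1..n}. \<exists>l<t. j \<in> A ! l \<and> P (A ! l) j})
        \<le> real ((\<Sum>l<t. card (R A l)) + t)"
      by (rule of_nat_mono)
    with card[OF A] have "k - t \<le> (\<Sum>l<t. real (card (R A l)))" by simp
    then have "(k - t) * F A \<le> (\<Sum>l<t. real (card (R A l))) * F A"
      by (intro mult_right_mono F_nonneg[OF A])
    also have "\<dots> = (\<Sum>l<t. \<Sum>j\<in>R A l. F A)"
      by (simp add: sum_distrib_right)
    also have "\<dots> \<le> (\<Sum>l<t. \<Sum>j\<in>R A l. C * F (split_off A l j))"
    proof (intro sum_mono)
      fix l j assume l: "l \<in> {..<t}" and j: "j \<in> R A l"
      then show "F A \<le> C * F (split_off A l j)"
        unfolding F_def length_split_off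
        using AD by (intro prod_le_prod_split_off nonneg split) (auto simp: R_def)
    qed
    finally show ?thesis by (simp add: sum_distrib_left)
  qed
  \<comment> \<open>For fixed \<open>l\<close>, the pairs \<open>(A, j)\<close> map injectively into
    the partitions with \<open>Suc t\<close> parts. The sum of \<open>F\<close> over the images is
    therefore part of a sum of nonnegative terms.\<close>
  have collect: "(\<Sum>A\<in>ordered_partitions t n. \<Sum>j\<in>R A l. F (split_off A l j)) \<le> sum F ?Q"
    if l: "l < t" for l
  proof -
    let ?D = "SIGMA A:ordered_partitions t n. R A l"
    let ?s = "\<lambda>(A, j). split_off A l j"
    have "inj_on ?s ?D"
    proof (rule inj_onI, clarify)
      fix A j A' j'
      assume "A \<in> ordered_partitions t n" "j \<in> R A l" "j' \<in> R A' l"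
        "split_off A l j = split_off A' l j'"
      then show "A = A' \<and> j = j'"
        using l by (intro split_off_inject) (auto simp: R_def dest: ordered_partitionsD(1))
    qed
    then have "sum F (?s ` ?D) = (\<Sum>(A, j)\<in>?D. F (split_off A l j))"
      by (simp add: sum.reindex case_prod_unfold)
    moreover have "sum F (?s ` ?D) \<le> sum F ?Q"
      using l by (intro sum_mono2 finite_ordered_partitions)
        (auto simp: R_def intro: split_off_ordered_partitions F_nonneg)
    ultimately show ?thesis
      using l fin by (subst sum.Sigma) (auto simp: finite_ordered_partitions)
  qed
  have "(k - t) * (\<Sum>A\<in>ordered_partitions t n. F A)
      \<le> (\<Sum>A\<in>ordered_partitions t n. C * (\<Sum>l<t. \<Sum>j\<in>R A l. F (split_off A l j)))"
    by (subst sum_distrib_left) (intro sum_mono pointwise)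
  also have "\<dots> = C * (\<Sum>l<t. \<Sum>A\<in>ordered_partitions t n. \<Sum>j\<in>R A l. F (split_off A l j))"
    unfolding sum_distrib_left[symmetric] by (subst sum.swap) simp
  also have "\<dots> \<le> C * (\<Sum>l<t. sum F ?Q)"
    by (intro mult_left_mono sum_mono collect C) simp
  finally have main: "(k - t) * (\<Sum>A\<in>ordered_partitions t n. F A) \<le> C * t * sum F ?Q"
    by (simp add: mult_ac)
  have "(\<Sum>A\<in>ordered_partitions s n. F A) = (\<Sum>A\<in>ordered_partitions s n. \<Prod>i<s. g (A ! i))" for s
    by (intro sum.cong) (simp_all add: F_def ordered_partitionsD(1))
  with main show ?thesis by simp
qed

section \<open>Real bounds from extended nonnegative ratios\<close>

lemma le_of_ennreal_divide_le:
  assumes "ennreal a / ennreal b \<le> ennreal C" "a \<ge> 0" "b \<ge> 0" "C \<ge> 0"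
  shows "a \<le> C * b"
proof (cases "b = 0")
  \<comment> \<open>A positive \<open>a\<close> would make the quotient infinite, so the finite
    bound forces \<open>a = 0\<close>.\<close>
  case True
  then show ?thesis using assms
    by (cases "a = 0") (auto simp: divide_ennreal_def ennreal_mult_top top_unique)
next
  case False
  then have "ennreal (a / b) \<le> ennreal C" using assms by (simp add: divide_ennreal)
  with False assms show ?thesis by (simp add: field_simps)
qed

lemma limsup_less_infinity_bound:
  fixes f :: "nat \<Rightarrow> ennreal"
  assumes "limsup f < \<infinity>"
  obtains C where "C \<ge> 0" "eventually (\<lambda>n. f n \<le> ennreal C) sequentially"
proof -
  obtain y where y: "limsup f < y" "y < \<infinity>" using assms dense by blast
  from Limsup_lessD[OF y(1)] have "eventually (\<lambda>n. f n < y) sequentially" .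
  moreover have "y = ennreal (enn2real y)" using y(2) by (simp add: less_top)
  ultimately have "eventually (\<lambda>n. f n \<le> ennreal (enn2real y)) sequentially"
    by (auto elim!: eventually_mono)
  then show ?thesis by (intro that[of "enn2real y"]) simp_all
qed

section \<open>Comparison of the joint weights for \<open>t\<close> and \<open>Suc t\<close>, and
  the posterior bound\<close>

context gibbs_partition_mixture
begin

lemma marginal_nonneg:
  assumes "\<And>j. j \<in> J \<Longrightarrow> x j \<in> \<X>"
  shows "marginal \<Theta> p \<pi> x J \<ge> 0"
  unfolding marginal_def
  by (rule integral_nonneg_AE, rule AE_I2)
    (auto simp: space_restrict_space intro!: mult_nonneg_nonneg prod_nonneg p_nonneg prior_nonneg assms)

text \<open>The factor \<open>v n t\<close> is common to all partitions into \<open>t\<close> parts.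
  What remains is a sum of products of one set function over the parts, the shape that
  \<open>sum_partitions_le_sum_split\<close> handles.\<close>

lemma joint_eq:
  "joint \<Theta> p \<pi> v w x n t = v n t *
     (\<Sum>A\<in>ordered_partitions t n. \<Prod>i<t. w n (card (A ! i)) * marginal \<Theta> p \<pi> x (A ! i))"
  unfolding joint_def sum_distrib_left
  by (rule sum.cong) (simp_all add: gibbs_weight_def prod.distrib ordered_partitionsD(1))

lemma weight_nonneg:
  assumes "\<And>j. j \<ge> 1 \<Longrightarrow> x j \<in> \<X>" "J \<subseteq> {1..n}" "J \<noteq> {}"
  shows "w n (card J) * marginal \<Theta> p \<pi> x J \<ge> 0"
proof (intro mult_nonneg_nonneg w_nonneg marginal_nonneg)
  have "finite J" using assms(2) finite_subset by blast
  then show "1 \<le> card J" using assms(3) by (simp add: Suc_le_eq card_gt_0_iff)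
  show "card J \<le> n" using card_mono[OF _ assms(2)] by simp
  show "x j \<in> \<X>" if "j \<in> J" for j using that assms(1,2) by auto
qed

lemma sum_prod_weight_nonneg:
  assumes "\<And>j. j \<ge> 1 \<Longrightarrow> x j \<in> \<X>"
  shows "(\<Sum>A\<in>ordered_partitions t n. \<Prod>i<t. w n (card (A ! i)) * marginal \<Theta> p \<pi> x (A ! i)) \<ge> 0"
proof (intro sum_nonneg prod_nonneg ballI)
  fix A i assume "A \<in> ordered_partitions t n" "i \<in> {..<t}"
  then show "w n (card (A ! i)) * marginal \<Theta> p \<pi> x (A ! i) \<ge> 0"
    using ordered_partitionsD(2,3) by (intro weight_nonneg assms) auto
qed

lemma joint_nonneg:
  assumes "\<And>j. j \<ge> 1 \<Longrightarrow> x j \<in> \<X>" "1 \<le> t" "t \<le> n"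
  shows "joint \<Theta> p \<pi> v w x n t \<ge> 0"
  unfolding joint_eq by (intro mult_nonneg_nonneg v_nonneg sum_prod_weight_nonneg assms)

text \<open>Splitting costs a factor \<open>Cw * n * c\<close>, but at least
  \<open>n * phi - t\<close> elements can be split off each partition. The two factors of
  \<open>n\<close> cancel, so the resulting constant does not depend on \<open>n\<close>.\<close>

lemma joint_le_joint_Suc:
  assumes x: "\<And>j. j \<ge> 1 \<Longrightarrow> x j \<in> \<X>" and t: "1 \<le> t" "t < n"
    and c: "c \<ge> 0" and Cw: "Cw \<ge> 0" "c_w w n \<le> ennreal Cw"
    and Cv: "Cv \<ge> 0" "c_v v t n \<le> ennreal Cv"
  shows "(phi \<Theta> p \<pi> t x n c - t / n) * joint \<Theta> p \<pi> v w x n t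
    \<le> Cw * Cv * c * t * joint \<Theta> p \<pi> v w x n (Suc t)"
proof -
  let ?m = "marginal \<Theta> p \<pi> x"
  define g where "g J = w n (card J) * ?m J" for J
  define S where "S s = (\<Sum>A\<in>ordered_partitions s n. \<Prod>i<s. g (A ! i))" for s
  \<comment> \<open>As \<open>phi\<close> is a minimum over partitions of
    \<open>card (split_set ...) / n\<close>, \<open>k\<close> bounds the size of the split set from
    below for every partition at once.\<close>
  define k where "k = n * phi \<Theta> p \<pi> t x n c"
  have joint: "joint \<Theta> p \<pi> v w x n s = v n s * S s" for s
    by (simp add: S_def g_def joint_eq)
  have S_nonneg: "S s \<ge> 0" for s
    unfolding S_def g_def by (rule sum_prod_weight_nonneg[OF x])
  \<comment> \<open>The factor \<open>a\<close> in the denominator of \<open>c_w\<close> is the size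
    of the part being split; bounding it by \<open>n\<close> makes the constant the same for all
    parts.\<close>
  have w_le: "w n a \<le> Cw * (n * (w n (a - 1) * w n 1))" if a: "2 \<le> a" "a \<le> n" for a
  proof -
    have "ennreal (w n a) / ennreal (real a * w n (a - 1) * w n 1) \<le> c_w w n"
      unfolding c_w_def using a by (intro Max_ge) auto
    also note Cw(2)
    finally have "w n a \<le> Cw * (real a * w n (a - 1) * w n 1)"
      using a Cw(1) by (intro le_of_ennreal_divide_le) (auto intro!: mult_nonneg_nonneg w_nonneg)
    also have "\<dots> = Cw * (real a * (w n (a - 1) * w n 1))" by simp
    also have "\<dots> \<le> Cw * (n * (w n (a - 1) * w n 1))"
      using a Cw(1) by (intro mult_left_mono mult_right_mono) (auto intro!: mult_nonneg_nonneg w_nonneg)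
    finally show ?thesis .
  qed
  have v_le: "v n t \<le> Cv * v n (Suc t)"
    using Cv t by (intro le_of_ennreal_divide_le) (auto simp: c_v_def intro!: v_nonneg)
  have "(k - t) * S t \<le> (Cw * n * c) * t * S (Suc t)"
    unfolding S_def
  proof (rule sum_partitions_le_sum_split[where P = "\<lambda>J j. ?m J \<le> c * ?m (J - {j}) * ?m {j}"])
    show "g J \<ge> 0" if "J \<subseteq> {1..n}" "J \<noteq> {}" for J
      unfolding g_def by (intro weight_nonneg x that)
    show "Cw * n * c \<ge> 0" using Cw c by simp
    show "k \<le> card {j \<in> {1..n}. \<exists>l<t. j \<in> A ! l \<and> ?m (A ! l) \<le> c * ?m (A ! l - {j}) * ?m {j}}"
      if A: "A \<in> ordered_partitions t n" for A
    proof -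
      have "phi \<Theta> p \<pi> t x n c \<le> card (split_set \<Theta> p \<pi> A x n c) / n"
        unfolding phi_def using A by (intro Min_le) (auto simp: finite_ordered_partitions)
      then have "k \<le> card (split_set \<Theta> p \<pi> A x n c)"
        using t by (simp add: k_def field_simps)
      then show ?thesis using ordered_partitionsD(1)[OF A] by (simp add: split_set_def)
    qed
    show "g J \<le> Cw * n * c * (g (J - {j}) * g {j})"
      if J: "J \<subseteq> {1..n}" "j \<in> J" "card J \<ge> 2" "?m J \<le> c * ?m (J - {j}) * ?m {j}" for J j
    proof -
      have fin: "finite J" using J finite_subset by blast
      have le: "card J \<le> n" using card_mono[OF _ J(1)] by simp
      have "g J \<le> (Cw * (n * (w n (card J - 1) * w n 1))) * (c * ?m (J - {j}) * ?m {j})"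
        unfolding g_def using J le Cw(1)
        by (intro mult_mono w_le mult_nonneg_nonneg w_nonneg marginal_nonneg x) auto
      also have "\<dots> = Cw * n * c * (g (J - {j}) * g {j})"
        using fin J by (simp add: g_def card_Diff_singleton mult_ac)
      finally show ?thesis .
    qed
  qed
  moreover have "k - t = n * (phi \<Theta> p \<pi> t x n c - t / n)"
    using t by (simp add: k_def right_diff_distrib)
  ultimately have "n * ((phi \<Theta> p \<pi> t x n c - t / n) * S t) \<le> n * (Cw * c * t * S (Suc t))"
    by (simp add: mult_ac)
  then have S_le: "(phi \<Theta> p \<pi> t x n c - t / n) * S t \<le> Cw * c * t * S (Suc t)"
    using t by (subst (asm) mult_le_cancel_left_pos) auto
  have "v n t * ((phi \<Theta> p \<pi> t x n c - t / n) * S t) \<le> v n t * (Cw * c * t * S (Suc t))"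
    using S_le t by (intro mult_left_mono v_nonneg) auto
  also have "\<dots> \<le> Cv * v n (Suc t) * (Cw * c * t * S (Suc t))"
    using v_le Cw c S_nonneg by (intro mult_right_mono) auto
  finally show ?thesis by (simp add: joint mult_ac)
qed

text \<open>Since \<open>t < n\<close>, the normalizing sum contains the terms for both
  \<open>t\<close> and \<open>Suc t\<close>, and the latter is at least \<open>1 / K\<close> times
  the former when \<open>K > 0\<close>.\<close>

lemma posterior_le:
  assumes x: "\<And>j. j \<ge> 1 \<Longrightarrow> x j \<in> \<X>" and t: "1 \<le> t" "t < n" and K: "K \<ge> 0"
    and le: "joint \<Theta> p \<pi> v w x n t \<le> K * joint \<Theta> p \<pi> v w x n (Suc t)"
  shows "posterior \<Theta> p \<pi> v w x n t \<le> K / (K + 1)"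
proof -
  let ?j = "joint \<Theta> p \<pi> v w x n"
  have "sum ?j {t, Suc t} \<le> sum ?j {1..n}"
    using t by (intro sum_mono2) (auto intro!: joint_nonneg x)
  then have two: "?j t + ?j (Suc t) \<le> sum ?j {1..n}" by simp
  have pos: "?j t \<ge> 0" "?j (Suc t) \<ge> 0" using t by (auto intro!: joint_nonneg x)
  show ?thesis
  proof (cases "sum ?j {1..n} = 0")
    \<comment> \<open>Division by zero yields posterior \<open>0\<close>, which is below the
      nonnegative bound.\<close>
    case True
    then show ?thesis using K by (simp add: posterior_def)
  next
    case False
    with two pos have D: "sum ?j {1..n} > 0" by linarith
    have "?j t * (K + 1) \<le> K * (?j t + ?j (Suc t))" using le by (simp add: algebra_simps)
    also have "\<dots> \<le> K * sum ?j {1..n}" using two K by (rule mult_left_mono)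
    finally show ?thesis using D K by (simp add: posterior_def field_simps)
  qed
qed

lemma limsup_posterior_less_1:
  assumes x: "\<And>j. j \<ge> 1 \<Longrightarrow> x j \<in> \<X>" and t: "1 \<le> t"
    and cw: "limsup (\<lambda>n. c_w w n) < \<infinity>" and cv: "limsup (\<lambda>n. c_v v t n) < \<infinity>"
    and phi: "(SUP c\<in>{0..}. liminf (\<lambda>n. ereal (phi \<Theta> p \<pi> t x n c))) > 0"
  shows "limsup (\<lambda>n. ereal (posterior \<Theta> p \<pi> v w x n t)) < 1"
proof -
  obtain Cw where Cw: "Cw \<ge> 0" "eventually (\<lambda>n. c_w w n \<le> ennreal Cw) sequentially"
    using limsup_less_infinity_bound[OF cw] .
  obtain Cv where Cv: "Cv \<ge> 0" "eventually (\<lambda>n. c_v v t n \<le> ennreal Cv) sequentially"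
    using limsup_less_infinity_bound[OF cv] .
  \<comment> \<open>A positive supremum is witnessed by a single \<open>c\<close>, which stays fixed
    for all \<open>n\<close> from here on.\<close>
  obtain c where c: "c \<ge> 0" "0 < liminf (\<lambda>n. ereal (phi \<Theta> p \<pi> t x n c))"
    using phi by (auto simp: less_SUP_iff)
  then obtain \<epsilon> where \<epsilon>: "0 < ereal \<epsilon>" "ereal \<epsilon> < liminf (\<lambda>n. ereal (phi \<Theta> p \<pi> t x n c))"
    using ereal_dense2 by blast
  have ev_phi: "eventually (\<lambda>n. \<epsilon> < phi \<Theta> p \<pi> t x n c) sequentially"
    using less_LiminfD[OF \<epsilon>(2)] by simp
  have "eventually (\<lambda>n. t / real n < \<epsilon> / 2) sequentially"
    using \<epsilon>(1) by (intro order_tendstoD(2)[OF lim_const_over_n]) simp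
  note evs = ev_phi this eventually_gt_at_top[of t] Cw(2) Cv(2)
  \<comment> \<open>Eventually \<open>phi - t / n\<close> exceeds \<open>\<epsilon> / 2\<close>.
    Dividing the comparison of joint weights by \<open>\<epsilon> / 2\<close> gives this
    constant.\<close>
  define K where "K = Cw * Cv * c * t * 2 / \<epsilon>"
  have K: "K \<ge> 0" using Cw Cv c \<epsilon> by (simp add: K_def)
  from evs have "eventually (\<lambda>n. ereal (posterior \<Theta> p \<pi> v w x n t) \<le> ereal (K / (K + 1))) sequentially"
  proof eventually_elim
    case (elim n)
    let ?j = "joint \<Theta> p \<pi> v w x n"
    have "\<epsilon> / 2 * ?j t \<le> (phi \<Theta> p \<pi> t x n c - t / n) * ?j t"
      using elim t by (intro mult_right_mono joint_nonneg x) auto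
    also have "\<dots> \<le> Cw * Cv * c * t * ?j (Suc t)"
      using elim Cw Cv c t by (intro joint_le_joint_Suc x)
    finally have "?j t \<le> K * ?j (Suc t)"
      using \<epsilon>(1) by (simp add: K_def field_simps)
    then show ?case
      using elim t K posterior_le[OF x] by simp
  qed
  then have "limsup (\<lambda>n. ereal (posterior \<Theta> p \<pi> v w x n t)) \<le> ereal (K / (K + 1))"
    by (rule Limsup_bounded)
  also have "\<dots> < 1" using K by simp
  finally show ?thesis .
qed

end

section \<open>From fixed data sequences to almost sure statements\<close>

theorem theorem3p4:
  fixes M :: "'a measure"
    and X :: "nat \<Rightarrow> 'a \<Rightarrow> real ^ 'd"
    and \<mu> :: "(real ^ 'd) measure" and \<X> :: "(real ^ 'd) set"
    and \<Theta> :: "(real ^ 'k) set"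
    and p :: "real ^ 'k \<Rightarrow> real ^ 'd \<Rightarrow> real" and \<pi> :: "real ^ 'k \<Rightarrow> real"
    and v w :: "nat \<Rightarrow> nat \<Rightarrow> real"
    and t :: nat
  assumes "prob_space M"
    and "\<And>j. j \<ge> 1 \<Longrightarrow> X j \<in> M \<rightarrow>\<^sub>M restrict_space borel \<X>"
    and "gibbs_partition_mixture \<mu> \<X> \<Theta> p \<pi> v w"
    and "t \<ge> 1"
    and "limsup (\<lambda>n. c_w w n) < \<infinity>"
    and "limsup (\<lambda>n. c_v v t n) < \<infinity>"
    and "AE \<omega> in M. (SUP c\<in>{0..}. liminf (\<lambda>n. ereal (phi \<Theta> p \<pi> t (\<lambda>j. X j \<omega>) n c))) > 0"
  shows "(AE \<omega> in M. limsup (\<lambda>n. ereal (posterior \<Theta> p \<pi> v w (\<lambda>j. X j \<omega>) n t)) < 1) \<and>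
    (iid_from_mixture M X \<mu> \<Theta> p t \<longrightarrow>
      (AE \<omega> in M. \<not> posterior_consistent \<Theta> p \<pi> v w (\<lambda>j. X j \<omega>) t))"
proof -
  interpret gibbs_partition_mixture \<mu> \<X> \<Theta> p \<pi> v w by fact
  have less: "AE \<omega> in M. limsup (\<lambda>n. ereal (posterior \<Theta> p \<pi> v w (\<lambda>j. X j \<omega>) n t)) < 1"
    \<comment> \<open>The deterministic bound is applied at each outcome with positive supremum;
      \<open>AE_space\<close> is needed to place the data values in \<open>\<X>\<close>.\<close>
    using assms(7) AE_space
  proof eventually_elim
    case (elim \<omega>)
    have "X j \<omega> \<in> \<X>" if "j \<ge> 1" for j
      using measurable_space[OF assms(2)[OF that] elim(2)] by (simp add: space_restrict_space)
    then show ?case using assms(4,5,6) elim(1) by (rule limsup_posterior_less_1)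
  qed
  moreover have "AE \<omega> in M. \<not> posterior_consistent \<Theta> p \<pi> v w (\<lambda>j. X j \<omega>) t"
    using less
  proof eventually_elim
    case (elim \<omega>)
    show ?case
    proof
      assume "posterior_consistent \<Theta> p \<pi> v w (\<lambda>j. X j \<omega>) t"
      then have "(\<lambda>n. ereal (posterior \<Theta> p \<pi> v w (\<lambda>j. X j \<omega>) n t)) \<longlonglongrightarrow> ereal 1"
        unfolding posterior_consistent_def by (rule tendsto_ereal)
      \<comment> \<open>Convergence to \<open>1\<close> would make the limit superior equal to
        \<open>1\<close>.\<close>
      from lim_imp_Limsup[OF _ this] elim show False by simp
    qed
  qed
  ultimately show ?thesis by blast
qed

end
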